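(* Let $1/2\le\theta\le1$ and consider the $\theta$-method with $\delta=\theta\tau$ (so $n_0=1$). Then the abstract energy hypothesis holds with the forcing-defect term omitted, that is: there are $c_E,C_E>0$ independent of $h$, $\tau$ and $m$ such that for all $\mathcal V_h$-valued sequences $V$ and all $1\le m\le N$ $$c_E\|T_\delta V^m\|_\Omega^2\le e_\tau^m(V),\qquad c_E\,\delta\|A_\tau V^m\|_\Omega^2\le d_\tau^m(V),$$ and every $\mathcal V_h$-valued solution of $(A_\tau V^n,T_\delta W)_\Omega=(R^n,T_\delta W)_\Omega$ for all $W\in\mathcal V_h$, $1\le n\le N$ (with $R^n\in\mathcal H$), satisfies for every $1\le m\le N$ $$e_\tau^m(V)+\tau\sum_{n=1}^md_\tau^n(V)\le C_E\|T_\delta V^0\|_\Omega^2+C_E\,\tau\sum_{n=1}^m(R^n,P_\delta V^n)_\Omega .$$ Consequently, if $U_h^n\in\mathcal V_h$ satisfies $(A_\tau U_h^n,T_\delta W)_\Omega=(\mathcal M_\theta F^n,T_\delta W)_\Omega$ for all $W\in\mathcal V_h$, $1\le n\le N$, then $$\|U_h\|_{\mathcal E,N}^2\lesssim\|T_\delta U_h^0\|_\Omega^2+\|\mathcal M_\theta F\|_{\mathcal E^*,N}^2 .$$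
   Context: Setting. $\mathcal H$ is a real Hilbert space with inner product $(\cdot,\cdot)_\Omega$ and norm $\|\cdot\|_\Omega$; $\mathcal V\subset\mathcal H$ is dense; $G:\mathcal V\to\mathcal H$ is linear, time independent, with $(GU,V)_\Omega=-(U,GV)_\Omega$ for all $U,V\in\mathcal V$; $\mathcal V_h\subset\mathcal V$ is a finite-dimensional (conforming finite element) subspace with mesh size $h$; $\tau>0$, $t^n=n\tau$, $0\le n\le N$, $N\ge1$; $F^n\in\mathcal H$, $0\le n\le N$, are the sampled data. For sequences, $D_\tau^-V^n=\tau^{-1}(V^n-V^{n-1})$ and $\mathcal M_\theta V^n=\theta V^n+(1-\theta)V^{n-1}$. With $\delta=\theta\tau$: $T_\delta=\mathrm{Id}+\delta G$, $S_\delta=\mathcal M_\theta+\delta D_\tau^-$, $A_\tau=D_\tau^-+G\mathcal M_\theta$, $P_\delta=T_\delta S_\delta$. Energy and dissipation: $$e_\tau^n(V)=\tfrac12\|T_\delta V^n\|_\Omega^2=\tfrac12\|V^n\|_\Omega^2+\tfrac12\delta^2\|GV^n\|_\Omega^2,$$ $$d_\tau^n(V)=\delta\|A_\tau V^n\|_\Omega^2+\tfrac{2\theta-1}{2}\tau\|D_\tau^-V^n\|_\Omega^2+\tfrac{2\theta-1}{2}\tau\delta^2\|GD_\tau^-V^n\|_\Omega^2 .$$ Norms: for $1\le m\le N$, $\|V\|_{\mathcal E,m}^2=\max_{1\le j\le m}e_\tau^j(V)+\tau\sum_{n=1}^md_\tau^n(V)$, and $$\|R\|_{\mathcal E^*,N}=\max_{1\le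 m\le N}\ \sup_V\ \frac{\tau\sum_{n=1}^m(R^n,P_\delta V^n)_\Omega}{\bigl(\|T_\delta V^0\|_\Omega^2+\|V\|_{\mathcal E,m}^2\bigr)^{1/2}},$$ the supremum being over $\mathcal V_h$-valued sequences with $V^n=0$ for $n\notin\{0,\dots,m\}$ and positive denominator. Convention: $a\lesssim b$ means $a\le Cb$ with $C>0$ independent of $h$, $\tau$ and $N$. *)

theory Defs
  imports "HOL-Analysis.Analysis"
begin

text \<open>
  Sequences are functions on \<^typ>\<open>nat\<close>. The two-level operators below refer to the index
  \<open>n - 1\<close> and are only ever used at \<open>n \<ge> 1\<close>, so that the truncated subtraction is harmless.
  The parameter \<open>\<delta>\<close> is kept separate; the \<open>\<theta>\<close>-method uses \<open>\<delta> = \<theta> * \<tau>\<close>.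
  The operator \<open>G\<close> is a total function in HOL, but only its values on the domain
  \<open>\<V>\<close> are constrained or used.
\<close>

definition skew_operator_on :: "'a::real_inner set \<Rightarrow> ('a \<Rightarrow> 'a) \<Rightarrow> bool" where
  "skew_operator_on \<V> G \<longleftrightarrow>
     (\<forall>u\<in>\<V>. \<forall>v\<in>\<V>. G (u + v) = G u + G v) \<and>
     (\<forall>c. \<forall>u\<in>\<V>. G (c *\<^sub>R u) = c *\<^sub>R G u) \<and>
     (\<forall>u\<in>\<V>. \<forall>v\<in>\<V>. inner (G u) v = - inner u (G v))"

definition conforming_space :: "'a::real_vector set \<Rightarrow> 'a set \<Rightarrow> bool" where
  "conforming_space \<V> \<V>h \<longleftrightarrow> subspace \<V>h \<and> \<V>h \<subseteq> \<V> \<and> (\<exists>B. finite B \<and> span B = \<V>h)"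

definition bdiff :: "real \<Rightarrow> (nat \<Rightarrow> 'a::real_vector) \<Rightarrow> nat \<Rightarrow> 'a" where
  "bdiff \<tau> V n = (1 / \<tau>) *\<^sub>R (V n - V (n - 1))"

definition mean_op :: "real \<Rightarrow> (nat \<Rightarrow> 'a::real_vector) \<Rightarrow> nat \<Rightarrow> 'a" where
  "mean_op \<theta> V n = \<theta> *\<^sub>R V n + (1 - \<theta>) *\<^sub>R V (n - 1)"

definition T_op :: "('a \<Rightarrow> 'a) \<Rightarrow> real \<Rightarrow> 'a \<Rightarrow> 'a::real_vector" where
  "T_op G \<delta> v = v + \<delta> *\<^sub>R G v"

definition S_op :: "real \<Rightarrow> real \<Rightarrow> real \<Rightarrow> (nat \<Rightarrow> 'a::real_vector) \<Rightarrow> nat \<Rightarrow> 'a" where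
  "S_op \<theta> \<tau> \<delta> V n = mean_op \<theta> V n + \<delta> *\<^sub>R bdiff \<tau> V n"

definition A_op :: "('a \<Rightarrow> 'a) \<Rightarrow> real \<Rightarrow> real \<Rightarrow> (nat \<Rightarrow> 'a::real_vector) \<Rightarrow> nat \<Rightarrow> 'a" where
  "A_op G \<theta> \<tau> V n = bdiff \<tau> V n + G (mean_op \<theta> V n)"

definition P_op :: "('a \<Rightarrow> 'a) \<Rightarrow> real \<Rightarrow> real \<Rightarrow> real \<Rightarrow> (nat \<Rightarrow> 'a::real_vector) \<Rightarrow> nat \<Rightarrow> 'a" where
  "P_op G \<theta> \<tau> \<delta> V n = T_op G \<delta> (S_op \<theta> \<tau> \<delta> V n)"

definition energy :: "('a::real_inner \<Rightarrow> 'a) \<Rightarrow> real \<Rightarrow> (nat \<Rightarrow> 'a) \<Rightarrow> nat \<Rightarrow> real" where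
  "energy G \<delta> V n = 1 / 2 * (norm (T_op G \<delta> (V n)))\<^sup>2"

definition dissipation ::
    "('a::real_inner \<Rightarrow> 'a) \<Rightarrow> real \<Rightarrow> real \<Rightarrow> real \<Rightarrow> (nat \<Rightarrow> 'a) \<Rightarrow> nat \<Rightarrow> real" where
  "dissipation G \<theta> \<tau> \<delta> V n =
     \<delta> * (norm (A_op G \<theta> \<tau> V n))\<^sup>2
     + (2 * \<theta> - 1) / 2 * \<tau> * (norm (bdiff \<tau> V n))\<^sup>2
     + (2 * \<theta> - 1) / 2 * \<tau> * \<delta>\<^sup>2 * (norm (G (bdiff \<tau> V n)))\<^sup>2"

definition energy_norm_sq ::
    "('a::real_inner \<Rightarrow> 'a) \<Rightarrow> real \<Rightarrow> real \<Rightarrow> real \<Rightarrow> nat \<Rightarrow> (nat \<Rightarrow> 'a) \<Rightarrow> real" where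
  "energy_norm_sq G \<theta> \<tau> \<delta> m V =
     Max ((\<lambda>j. energy G \<delta> V j) ` {1..m}) + \<tau> * (\<Sum>n=1..m. dissipation G \<theta> \<tau> \<delta> V n)"

definition dual_denom_sq ::
    "('a::real_inner \<Rightarrow> 'a) \<Rightarrow> real \<Rightarrow> real \<Rightarrow> real \<Rightarrow> nat \<Rightarrow> (nat \<Rightarrow> 'a) \<Rightarrow> real" where
  "dual_denom_sq G \<theta> \<tau> \<delta> m V =
     (norm (T_op G \<delta> (V 0)))\<^sup>2 + energy_norm_sq G \<theta> \<tau> \<delta> m V"

definition dual_ratios ::
    "('a::real_inner \<Rightarrow> 'a) \<Rightarrow> real \<Rightarrow> real \<Rightarrow> real \<Rightarrow> 'a set \<Rightarrow> (nat \<Rightarrow> 'a) \<Rightarrow> nat \<Rightarrow> real set" where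
  "dual_ratios G \<theta> \<tau> \<delta> \<V>h R m =
     {\<tau> * (\<Sum>n=1..m. inner (R n) (P_op G \<theta> \<tau> \<delta> V n)) / sqrt (dual_denom_sq G \<theta> \<tau> \<delta> m V) | V.
        (\<forall>n. V n \<in> \<V>h) \<and> (\<forall>n>m. V n = 0) \<and> dual_denom_sq G \<theta> \<tau> \<delta> m V > 0}"

text \<open>
  A nonempty set of ratios is symmetric under \<open>V \<mapsto> -V\<close>, so its supremum is nonnegative
  and inserting \<open>0\<close> does not change it. The insertion only fixes the value \<open>0\<close> in the degenerate
  case \<open>\<V>h = {0}\<close>, where there is no admissible \<open>V\<close>. The supremum is a genuine real supremum by
  \<open>bdd_above_dual_ratios\<close> below.
\<close>

definition dual_norm ::
    "('a::real_inner \<Rightarrow> 'a) \<Rightarrow> real \<Rightarrow> real \<Rightarrow> real \<Rightarrow> 'a set \<Rightarrow> nat \<Rightarrow> (nat \<Rightarrow> 'a) \<Rightarrow> real" where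
  "dual_norm G \<theta> \<tau> \<delta> \<V>h N R =
     Max ((\<lambda>m. Sup (insert 0 (dual_ratios G \<theta> \<tau> \<delta> \<V>h R m))) ` {1..N})"

definition discrete_solution ::
    "('a::real_inner \<Rightarrow> 'a) \<Rightarrow> real \<Rightarrow> real \<Rightarrow> real \<Rightarrow> 'a set \<Rightarrow> nat \<Rightarrow> (nat \<Rightarrow> 'a) \<Rightarrow> (nat \<Rightarrow> 'a) \<Rightarrow> bool"
  where
  "discrete_solution G \<theta> \<tau> \<delta> \<V>h N R V \<longleftrightarrow>
     (\<forall>n\<in>{0..N}. V n \<in> \<V>h) \<and>
     (\<forall>n\<in>{1..N}. \<forall>W\<in>\<V>h. inner (A_op G \<theta> \<tau> V n) (T_op G \<delta> W) = inner (R n) (T_op G \<delta> W))"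

lemma energy_eq:
  assumes "skew_operator_on \<V> G" "V n \<in> \<V>"
  shows "energy G \<delta> V n = 1 / 2 * (norm (V n))\<^sup>2 + 1 / 2 * \<delta>\<^sup>2 * (norm (G (V n)))\<^sup>2"
proof -
  have "inner (G (V n)) (V n) = - inner (V n) (G (V n))"
    using assms by (auto simp: skew_operator_on_def)
  then have "inner (V n) (G (V n)) = 0" "inner (G (V n)) (V n) = 0"
    by (simp_all add: inner_commute)
  then show ?thesis
    unfolding energy_def T_op_def power2_norm_eq_inner
    by (simp add: inner_add_left inner_add_right power2_eq_square algebra_simps)
qed

lemma bdd_above_dual_ratios:
  assumes G: "skew_operator_on \<V> G" and Vh: "subspace \<V>h" "\<V>h \<subseteq> \<V>"
    and \<theta>: "1 / 2 \<le> \<theta>" "\<theta> \<le> 1" and \<tau>: "\<tau> > 0"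
  shows "bdd_above (dual_ratios G \<theta> \<tau> (\<theta> * \<tau>) \<V>h R m)"
proof (rule bdd_aboveI)
  let ?d = "\<theta> * \<tau>"
  let ?T = "T_op G ?d"
  let ?B = "\<tau> * (\<Sum>n=1..m. norm (R n) * 5)"
  fix r assume "r \<in> dual_ratios G \<theta> \<tau> ?d \<V>h R m"
  then obtain V where V: "\<And>n. V n \<in> \<V>h"
    and pos: "dual_denom_sq G \<theta> \<tau> ?d m V > 0"
    and r: "r = \<tau> * (\<Sum>n=1..m. inner (R n) (P_op G \<theta> \<tau> ?d V n)) / sqrt (dual_denom_sq G \<theta> \<tau> ?d m V)"
    by (auto simp: dual_ratios_def)
  define q where "q = sqrt (dual_denom_sq G \<theta> \<tau> ?d m V)"
  have q: "q > 0" "q\<^sup>2 = dual_denom_sq G \<theta> \<tau> ?d m V"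
    using pos by (simp_all add: q_def)
  have diss: "\<tau> * (\<Sum>n=1..m. dissipation G \<theta> \<tau> ?d V n) \<ge> 0"
    using \<theta> \<tau> by (intro mult_nonneg_nonneg sum_nonneg) (auto simp: dissipation_def)
  have T_le: "norm (?T (V n)) \<le> 5 / 3 * q" if n: "n \<le> m" "1 \<le> m" for n
  proof (rule power2_le_imp_le)
    have e0: "energy G ?d V j \<le> Max ((\<lambda>j. energy G ?d V j) ` {1..m})" if "j \<in> {1..m}" for j
      using that by (intro Max_ge) auto
    have "0 \<le> energy G ?d V 1"
      by (simp add: energy_def)
    also have "\<dots> \<le> Max ((\<lambda>j. energy G ?d V j) ` {1..m})"
      by (rule e0) (use n in simp)
    finally have Mx: "0 \<le> Max ((\<lambda>j. energy G ?d V j) ` {1..m})" .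
    have "(norm (?T (V n)))\<^sup>2 \<le> 2 * q\<^sup>2"
    proof (cases "n = 0")
      case True
      then show ?thesis
        using Mx diss by (simp add: q(2) dual_denom_sq_def energy_norm_sq_def)
    next
      case False
      then have "energy G ?d V n \<le> Max ((\<lambda>j. energy G ?d V j) ` {1..m})"
        using n by (intro e0) simp
      then have "energy G ?d V n \<le> q\<^sup>2"
        unfolding q(2) dual_denom_sq_def energy_norm_sq_def
        using diss zero_le_power2[of "norm (?T (V 0))"] by linarith
      then show ?thesis
        by (simp add: energy_def)
    qed
    also have "\<dots> \<le> (5 / 3 * q)\<^sup>2"
      by (simp add: power_mult_distrib power2_eq_square)
    finally show "(norm (?T (V n)))\<^sup>2 \<le> (5 / 3 * q)\<^sup>2" .
  qed (use q in simp)
  have P_le: "norm (P_op G \<theta> \<tau> ?d V n) \<le> 5 * q" if n: "n \<in> {1..m}" for n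
  proof -
    have S: "S_op \<theta> \<tau> ?d V n = (2 * \<theta>) *\<^sub>R V n + (1 - 2 * \<theta>) *\<^sub>R V (n - 1)"
    proof -
      have "\<theta> * \<tau> * (1 / \<tau>) = \<theta>"
        using \<tau> by simp
      then have "?d *\<^sub>R bdiff \<tau> V n = \<theta> *\<^sub>R (V n - V (n - 1))"
        by (simp only: bdiff_def scaleR_scaleR)
      then have "S_op \<theta> \<tau> ?d V n = mean_op \<theta> V n + \<theta> *\<^sub>R (V n - V (n - 1))"
        by (simp only: S_op_def)
      also have "\<dots> = (\<theta> + \<theta>) *\<^sub>R V n + (1 - (\<theta> + \<theta>)) *\<^sub>R V (n - 1)"
        unfolding mean_op_def scaleR_diff_right scaleR_diff_left scaleR_add_left by simp
      finally show ?thesis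
        by (simp only: mult_2)
    qed
    have mem: "c *\<^sub>R V k \<in> \<V>" "V k \<in> \<V>" for c k
      using V Vh by (auto intro: subspace_scale)
    have "G (S_op \<theta> \<tau> ?d V n) = (2 * \<theta>) *\<^sub>R G (V n) + (1 - 2 * \<theta>) *\<^sub>R G (V (n - 1))"
    proof -
      have add: "G (u + v) = G u + G v" if "u \<in> \<V>" "v \<in> \<V>" for u v
        using G that by (simp add: skew_operator_on_def)
      have scale: "G (c *\<^sub>R u) = c *\<^sub>R G u" if "u \<in> \<V>" for c u
        using G that by (simp add: skew_operator_on_def)
      show ?thesis
        unfolding S by (simp only: add scale mem)
    qed
    then have "P_op G \<theta> \<tau> ?d V n = (2 * \<theta>) *\<^sub>R ?T (V n) + (1 - 2 * \<theta>) *\<^sub>R ?T (V (n - 1))"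
      unfolding P_op_def T_op_def S
      by (simp only: scaleR_add_right scaleR_scaleR add_ac mult_ac)
    then have "norm (P_op G \<theta> \<tau> ?d V n)
        \<le> \<bar>2 * \<theta>\<bar> * norm (?T (V n)) + \<bar>1 - 2 * \<theta>\<bar> * norm (?T (V (n - 1)))"
      using norm_triangle_ineq[of "(2 * \<theta>) *\<^sub>R ?T (V n)" "(1 - 2 * \<theta>) *\<^sub>R ?T (V (n - 1))"]
      by (simp only: norm_scaleR)
    also have "\<dots> \<le> 2 * (5 / 3 * q) + 1 * (5 / 3 * q)"
      using \<theta> q n by (intro add_mono mult_mono T_le) auto
    finally show ?thesis by simp
  qed
  have "inner (R n) (P_op G \<theta> \<tau> ?d V n) \<le> norm (R n) * 5 * q" if "n \<in> {1..m}" for n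
    using norm_cauchy_schwarz[of "R n" "P_op G \<theta> \<tau> ?d V n"]
      mult_left_mono[OF P_le[OF that], of "norm (R n)"] by simp
  then have "(\<Sum>n=1..m. inner (R n) (P_op G \<theta> \<tau> ?d V n)) \<le> (\<Sum>n=1..m. norm (R n) * 5) * q"
    unfolding sum_distrib_right by (intro sum_mono) auto
  then have "\<tau> * (\<Sum>n=1..m. inner (R n) (P_op G \<theta> \<tau> ?d V n)) \<le> ?B * q"
    using \<tau> by (simp add: mult.assoc)
  then show "r \<le> ?B"
    unfolding r q_def[symmetric] using q by (simp add: pos_divide_le_eq)
qed

end

theory Submission
  imports Defs
begin

text \<open>
  Testing the scheme with \<open>W = S\<^sub>\<delta> V\<^sup>n\<close> gives an exact energy balance. Since
  \<open>T\<^sub>\<delta> S\<^sub>\<delta> V = M V + \<delta> A V + \<delta>\<^sup>2 G D V\<close>, skew-symmetry leaves three terms in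
  \<open>(A V, T\<^sub>\<delta> S\<^sub>\<delta> V)\<close>: the stabilisation \<open>\<delta> \<parallel>A V\<parallel>\<^sup>2\<close>, the product \<open>(D V, M V)\<close>, and
  \<open>\<delta>\<^sup>2 (G D V, G M V)\<close>. Each of the last two is a backward difference of half a squared norm
  plus a nonnegative multiple of the squared norm of a difference, which is where \<open>\<theta> \<ge> 1/2\<close>
  enters. Hence \<open>(A V, P\<^sub>\<delta> V)\<close> is the backward difference of the energy plus the dissipation
  (\<open>tested_scheme_identity\<close>), and summation in time gives the energy hypothesis with
  \<open>c\<^sub>E = 1/2\<close> and \<open>C\<^sub>E = 1\<close>.

  For the a priori bound, cut the solution off after step \<open>m\<close>. The result is an admissible test
  sequence for the dual norm, so the work of the forcing up to \<open>m\<close> is at most \<open>q s\<close>, where \<open>q\<close>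
  is the dual norm of the forcing and \<open>s\<^sup>2 = \<parallel>T\<^sub>\<delta> U\<^sup>0\<parallel>\<^sup>2 + \<parallel>U\<parallel>\<^sup>2\<close> with the energy norm up to the
  final time. The balance at the index of maximal energy and the balance at the final index
  together control the energy norm, and \<open>2 q s \<le> 2 q\<^sup>2 + s\<^sup>2 / 2\<close> absorbs the solution on the right.
\<close>

section \<open>Skew operators and the time-stepping operators\<close>

lemma skew_operator_on_add:
  "skew_operator_on \<V> G \<Longrightarrow> u \<in> \<V> \<Longrightarrow> v \<in> \<V> \<Longrightarrow> G (u + v) = G u + G v"
  by (simp add: skew_operator_on_def)

lemma skew_operator_on_scaleR:
  "skew_operator_on \<V> G \<Longrightarrow> u \<in> \<V> \<Longrightarrow> G (c *\<^sub>R u) = c *\<^sub>R G u"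
  by (simp add: skew_operator_on_def)

lemma skew_operator_on_inner_self:
  assumes "skew_operator_on \<V> G" "u \<in> \<V>"
  shows "inner (G u) u = 0"
proof -
  have "inner (G u) u = - inner u (G u)"
    using assms by (simp add: skew_operator_on_def)
  then show ?thesis
    by (simp add: inner_commute)
qed

lemma bdiff_in_subspace:
  "subspace \<V> \<Longrightarrow> V n \<in> \<V> \<Longrightarrow> V (n - 1) \<in> \<V> \<Longrightarrow> bdiff \<tau> V n \<in> \<V>"
  by (simp add: bdiff_def subspace_diff subspace_scale)

lemma mean_op_in_subspace:
  "subspace \<V> \<Longrightarrow> V n \<in> \<V> \<Longrightarrow> V (n - 1) \<in> \<V> \<Longrightarrow> mean_op \<theta> V n \<in> \<V>"
  by (simp add: mean_op_def subspace_add subspace_scale)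

lemma skew_operator_on_mean_op:
  assumes "skew_operator_on \<V> G" "subspace \<V>" "V n \<in> \<V>" "V (n - 1) \<in> \<V>"
  shows "G (mean_op \<theta> V n) = mean_op \<theta> (\<lambda>k. G (V k)) n"
  using assms unfolding mean_op_def
  by (simp add: skew_operator_on_add skew_operator_on_scaleR subspace_scale)

lemma skew_operator_on_bdiff:
  assumes G: "skew_operator_on \<V> G" and "subspace \<V>" "V n \<in> \<V>" "V (n - 1) \<in> \<V>"
  shows "G (bdiff \<tau> V n) = bdiff \<tau> (\<lambda>k. G (V k)) n"
proof -
  have "bdiff \<tau> V n = (1 / \<tau>) *\<^sub>R V n + (- 1 / \<tau>) *\<^sub>R V (n - 1)"
    by (simp add: bdiff_def scaleR_diff_right)
  also have "G \<dots> = (1 / \<tau>) *\<^sub>R G (V n) + (- 1 / \<tau>) *\<^sub>R G (V (n - 1))"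
    using assms by (simp only: skew_operator_on_add[OF G] skew_operator_on_scaleR[OF G] subspace_scale)
  also have "\<dots> = bdiff \<tau> (\<lambda>k. G (V k)) n"
    by (simp add: bdiff_def scaleR_diff_right)
  finally show ?thesis .
qed

section \<open>The energy balance\<close>

text \<open>
  The mean is \<open>(V\<^sup>n + V\<^sup>n\<^sup>-\<^sup>1) / 2 + (\<theta> - 1/2) (V\<^sup>n - V\<^sup>n\<^sup>-\<^sup>1)\<close>: the midpoint part telescopes,
  and the excess over the midpoint rule is dissipative for \<open>\<theta> \<ge> 1/2\<close>.
\<close>

lemma inner_bdiff_mean_op:
  fixes V :: "nat \<Rightarrow> 'a::real_inner"
  assumes "\<tau> \<noteq> 0"
  shows "\<tau> * inner (bdiff \<tau> V n) (mean_op \<theta> V n)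
    = 1 / 2 * (norm (V n))\<^sup>2 - 1 / 2 * (norm (V (n - 1)))\<^sup>2
      + \<tau> * ((2 * \<theta> - 1) / 2 * \<tau> * (norm (bdiff \<tau> V n))\<^sup>2)"
proof -
  have diff: "V n - V (n - 1) = \<tau> *\<^sub>R bdiff \<tau> V n"
    using assms by (simp add: bdiff_def)
  have "\<tau> * inner (bdiff \<tau> V n) (mean_op \<theta> V n) = inner (V n - V (n - 1)) (mean_op \<theta> V n)"
    unfolding diff by simp
  also have "\<dots> = 1 / 2 * (norm (V n))\<^sup>2 - 1 / 2 * (norm (V (n - 1)))\<^sup>2
      + (2 * \<theta> - 1) / 2 * (norm (V n - V (n - 1)))\<^sup>2"
    unfolding mean_op_def power2_norm_eq_inner
    by (simp add: inner_add_right inner_diff_left inner_diff_right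
        inner_commute[of "V (n - Suc 0)" "V n"] field_simps)
  also have "(norm (V n - V (n - 1)))\<^sup>2 = \<tau>\<^sup>2 * (norm (bdiff \<tau> V n))\<^sup>2"
    unfolding diff by (simp add: power_mult_distrib)
  finally show ?thesis
    by (simp add: power2_eq_square algebra_simps)
qed

text \<open>
  The two products that survive by skew-symmetry are instances of \<open>inner_bdiff_mean_op\<close>, one for
  the sequence \<open>V\<close> and one for \<open>G V\<close>. Together their telescoping parts form the energy.
\<close>

lemma tested_scheme_identity:
  assumes G: "skew_operator_on \<V> G" and sub: "subspace \<V>" and \<tau>: "\<tau> \<noteq> 0"
    and V: "V n \<in> \<V>" "V (n - 1) \<in> \<V>"
  shows "\<tau> * inner (A_op G \<theta> \<tau> V n) (P_op G \<theta> \<tau> \<delta> V n)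
    = energy G \<delta> V n - energy G \<delta> V (n - 1) + \<tau> * dissipation G \<theta> \<tau> \<delta> V n"
proof -
  define D where "D = bdiff \<tau> V n"
  define M where "M = mean_op \<theta> V n"
  define A where "A = A_op G \<theta> \<tau> V n"
  have mem: "D \<in> \<V>" "M \<in> \<V>"
    using sub V by (simp_all add: D_def M_def bdiff_in_subspace mean_op_in_subspace)
  have A: "A = D + G M"
    by (simp add: A_def A_op_def D_def M_def)
  have "G (M + \<delta> *\<^sub>R D) = G M + \<delta> *\<^sub>R G D"
    using mem sub by (simp add: skew_operator_on_add[OF G] skew_operator_on_scaleR[OF G] subspace_scale)
  then have P: "P_op G \<theta> \<tau> \<delta> V n = M + \<delta> *\<^sub>R A + \<delta>\<^sup>2 *\<^sub>R G D"
    unfolding P_op_def T_op_def S_op_def A D_def[symmetric] M_def[symmetric]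
    by (simp add: algebra_simps power2_eq_square)
  have "inner A M = inner D M" "inner A (G D) = inner (G D) (G M)"
    using skew_operator_on_inner_self[OF G mem(1)] skew_operator_on_inner_self[OF G mem(2)]
    by (simp_all add: A inner_add_left inner_commute[of D "G D"] inner_commute[of "G M" "G D"])
  then have "\<tau> * inner A (P_op G \<theta> \<tau> \<delta> V n)
      = \<tau> * inner D M + \<tau> * (\<delta> * (norm A)\<^sup>2) + \<delta>\<^sup>2 * (\<tau> * inner (G D) (G M))"
    unfolding P by (simp add: inner_add_right power2_norm_eq_inner algebra_simps)
  also have "\<tau> * inner (G D) (G M) = 1 / 2 * (norm (G (V n)))\<^sup>2 - 1 / 2 * (norm (G (V (n - 1))))\<^sup>2
      + \<tau> * ((2 * \<theta> - 1) / 2 * \<tau> * (norm (G D))\<^sup>2)"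
    unfolding D_def M_def skew_operator_on_bdiff[of \<V> G, OF G sub V]
      skew_operator_on_mean_op[of \<V> G, OF G sub V]
    by (rule inner_bdiff_mean_op[OF \<tau>])
  also have "\<tau> * inner D M = 1 / 2 * (norm (V n))\<^sup>2 - 1 / 2 * (norm (V (n - 1)))\<^sup>2
      + \<tau> * ((2 * \<theta> - 1) / 2 * \<tau> * (norm D)\<^sup>2)"
    unfolding D_def M_def by (rule inner_bdiff_mean_op[OF \<tau>])
  finally show ?thesis
    unfolding energy_eq[of \<V> G V, OF G V(1)] energy_eq[of \<V> G V, OF G V(2)] dissipation_def
      A_def[symmetric] D_def[symmetric]
    by (simp add: algebra_simps)
qed

lemma discrete_solution_energy_balance:
  assumes G: "skew_operator_on \<V> G" and sub: "subspace \<V>h" "\<V>h \<subseteq> \<V>" and \<tau>: "\<tau> \<noteq> 0"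
    and sol: "discrete_solution G \<theta> \<tau> \<delta> \<V>h N R V" and "m \<le> N"
  shows "energy G \<delta> V m + \<tau> * (\<Sum>n=1..m. dissipation G \<theta> \<tau> \<delta> V n)
    = energy G \<delta> V 0 + \<tau> * (\<Sum>n=1..m. inner (R n) (P_op G \<theta> \<tau> \<delta> V n))"
  using \<open>m \<le> N\<close>
proof (induction m)
  case 0
  then show ?case by simp
next
  case (Suc m)
  have G': "skew_operator_on \<V>h G"
    using G sub(2) by (auto simp: skew_operator_on_def subset_iff)
  have V: "V (Suc m) \<in> \<V>h" "V (Suc m - 1) \<in> \<V>h"
    using sol Suc.prems by (auto simp: discrete_solution_def)
  have "S_op \<theta> \<tau> \<delta> V (Suc m) \<in> \<V>h"
    unfolding S_op_def using sub(1) V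
    by (intro subspace_add subspace_scale mean_op_in_subspace bdiff_in_subspace)
  then have "inner (A_op G \<theta> \<tau> V (Suc m)) (P_op G \<theta> \<tau> \<delta> V (Suc m))
      = inner (R (Suc m)) (P_op G \<theta> \<tau> \<delta> V (Suc m))"
    using sol Suc.prems unfolding discrete_solution_def P_op_def by auto
  then have "\<tau> * inner (R (Suc m)) (P_op G \<theta> \<tau> \<delta> V (Suc m))
      = energy G \<delta> V (Suc m) - energy G \<delta> V m + \<tau> * dissipation G \<theta> \<tau> \<delta> V (Suc m)"
    using tested_scheme_identity[of \<V>h G, OF G' sub(1) \<tau> V, of \<theta> \<delta>] by simp
  then show ?case
    using Suc by (simp add: distrib_left)
qed

section \<open>The energy norm\<close>

lemma dissipation_ge_residual:
  assumes "1 / 2 \<le> \<theta>" "\<tau> \<ge> 0"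
  shows "\<delta> * (norm (A_op G \<theta> \<tau> V n))\<^sup>2 \<le> dissipation G \<theta> \<tau> \<delta> V n"
  using assms by (simp add: dissipation_def)

lemma dissipation_nonneg:
  assumes "1 / 2 \<le> \<theta>" "\<tau> \<ge> 0" "\<delta> \<ge> 0"
  shows "0 \<le> dissipation G \<theta> \<tau> \<delta> V n"
  using assms by (simp add: dissipation_def)

lemma energy_plus_dissipation_le_energy_norm_sq:
  assumes "m \<ge> 1"
  shows "energy G \<delta> V m + \<tau> * (\<Sum>n=1..m. dissipation G \<theta> \<tau> \<delta> V n) \<le> energy_norm_sq G \<theta> \<tau> \<delta> m V"
  using assms by (auto simp: energy_norm_sq_def intro!: Max_ge)

lemma energy_norm_sq_mono:
  assumes "1 / 2 \<le> \<theta>" "\<tau> \<ge> 0" "\<delta> \<ge> 0" "1 \<le> m" "m \<le> N"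
  shows "energy_norm_sq G \<theta> \<tau> \<delta> m V \<le> energy_norm_sq G \<theta> \<tau> \<delta> N V"
proof -
  have "Max (energy G \<delta> V ` {1..m}) \<le> Max (energy G \<delta> V ` {1..N})"
    using assms by (intro Max_mono) auto
  moreover have "(\<Sum>n=1..m. dissipation G \<theta> \<tau> \<delta> V n) \<le> (\<Sum>n=1..N. dissipation G \<theta> \<tau> \<delta> V n)"
    using assms by (intro sum_mono2 dissipation_nonneg) auto
  ultimately show ?thesis
    unfolding energy_norm_sq_def using assms by (intro add_mono mult_left_mono) auto
qed

text \<open>
  The factor 2 arises because the maximal energy and the total dissipation are controlled by the
  bound at different indices, the former at the index where the maximum is attained and the latter
  at \<open>N\<close>.
\<close>

lemma energy_norm_sq_le:
  assumes pos: "1 / 2 \<le> \<theta>" "\<tau> \<ge> 0" "\<delta> \<ge> 0" and "N \<ge> 1"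
    and bound: "\<And>m. m \<in> {1..N} \<Longrightarrow>
      energy G \<delta> V m + \<tau> * (\<Sum>n=1..m. dissipation G \<theta> \<tau> \<delta> V n) \<le> b"
  shows "energy_norm_sq G \<theta> \<tau> \<delta> N V \<le> 2 * b"
proof -
  have diss: "0 \<le> \<tau> * (\<Sum>n=1..m. dissipation G \<theta> \<tau> \<delta> V n)" for m
    using pos by (intro mult_nonneg_nonneg sum_nonneg dissipation_nonneg)
  have "energy G \<delta> V j \<le> b" if "j \<in> {1..N}" for j
    using bound[OF that] diss[of j] by linarith
  then have "Max (energy G \<delta> V ` {1..N}) \<le> b"
    using \<open>N \<ge> 1\<close> by (intro Max.boundedI) auto
  moreover have "\<tau> * (\<Sum>n=1..N. dissipation G \<theta> \<tau> \<delta> V n) \<le> b"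
  proof -
    have "0 \<le> energy G \<delta> V N"
      by (simp add: energy_def)
    then show ?thesis
      using bound[of N] \<open>N \<ge> 1\<close> by simp
  qed
  ultimately show ?thesis
    by (simp add: energy_norm_sq_def)
qed

section \<open>The dual norm of the forcing\<close>

text \<open>
  The quotients of the dual norm run over sequences that vanish after \<open>m\<close>. Cutting \<open>V\<close> off there
  alters neither the numerator nor the denominator, because both see only the indices up to \<open>m\<close>.
\<close>

lemma forcing_work_le_dual_norm:
  assumes G: "skew_operator_on \<V> G" and sub: "subspace \<V>h" "\<V>h \<subseteq> \<V>"
    and \<theta>: "1 / 2 \<le> \<theta>" "\<theta> \<le> 1" and \<tau>: "\<tau> > 0" and \<delta>: "\<delta> = \<theta> * \<tau>" and m: "m \<in> {1..N}"
    and V: "\<And>n. n \<le> m \<Longrightarrow> V n \<in> \<V>h" and pos: "dual_denom_sq G \<theta> \<tau> \<delta> m V > 0"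
  shows "\<tau> * (\<Sum>n=1..m. inner (R n) (P_op G \<theta> \<tau> \<delta> V n))
    \<le> dual_norm G \<theta> \<tau> \<delta> \<V>h N R * sqrt (dual_denom_sq G \<theta> \<tau> \<delta> m V)"
proof -
  define W where "W n = (if n \<le> m then V n else 0)" for n
  define ratio where "ratio = \<tau> * (\<Sum>n=1..m. inner (R n) (P_op G \<theta> \<tau> \<delta> V n))
    / sqrt (dual_denom_sq G \<theta> \<tau> \<delta> m V)"
  have local_ops: "bdiff \<tau> W n = bdiff \<tau> V n" "mean_op \<theta> W n = mean_op \<theta> V n" if "n \<le> m" for n
    using that le_trans[OF diff_le_self that, of 1] by (simp_all add: W_def bdiff_def mean_op_def)
  have "Max (energy G \<delta> W ` {1..m}) = Max (energy G \<delta> V ` {1..m})"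
    by (intro arg_cong[where f = Max] image_cong) (simp_all add: energy_def W_def)
  moreover have "(\<Sum>n=1..m. dissipation G \<theta> \<tau> \<delta> W n) = (\<Sum>n=1..m. dissipation G \<theta> \<tau> \<delta> V n)"
    by (intro sum.cong) (simp_all add: dissipation_def A_op_def local_ops)
  ultimately have denom: "dual_denom_sq G \<theta> \<tau> \<delta> m W = dual_denom_sq G \<theta> \<tau> \<delta> m V"
    by (simp add: dual_denom_sq_def energy_norm_sq_def W_def)
  have "(\<Sum>n=1..m. inner (R n) (P_op G \<theta> \<tau> \<delta> W n)) = (\<Sum>n=1..m. inner (R n) (P_op G \<theta> \<tau> \<delta> V n))"
    by (intro sum.cong) (simp_all add: P_op_def S_op_def local_ops)
  moreover have "W n \<in> \<V>h" for n
    using V sub(1) by (simp add: W_def subspace_0)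
  moreover have "\<forall>n>m. W n = 0"
    by (simp add: W_def)
  ultimately have "ratio \<in> dual_ratios G \<theta> \<tau> \<delta> \<V>h R m"
    unfolding dual_ratios_def ratio_def using denom pos by (intro CollectI exI[of _ W]) simp
  moreover have "bdd_above (insert 0 (dual_ratios G \<theta> \<tau> \<delta> \<V>h R m))"
    unfolding \<delta> using bdd_above_dual_ratios[OF G sub \<theta> \<tau>] by simp
  ultimately have "ratio \<le> Sup (insert 0 (dual_ratios G \<theta> \<tau> \<delta> \<V>h R m))"
    by (intro cSup_upper) simp_all
  also have "\<dots> \<le> dual_norm G \<theta> \<tau> \<delta> \<V>h N R"
    unfolding dual_norm_def using m by (intro Max_ge) auto
  finally show ?thesis
    using pos by (simp add: ratio_def pos_divide_le_eq)
qed

lemma dual_norm_nonneg: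
  assumes "skew_operator_on \<V> G" "subspace \<V>h" "\<V>h \<subseteq> \<V>"
    and "1 / 2 \<le> \<theta>" "\<theta> \<le> 1" "\<tau> > 0" and \<delta>: "\<delta> = \<theta> * \<tau>" and "N \<ge> 1"
  shows "0 \<le> dual_norm G \<theta> \<tau> \<delta> \<V>h N R"
proof -
  have "0 \<le> Sup (insert 0 (dual_ratios G \<theta> \<tau> \<delta> \<V>h R N))"
    unfolding \<delta> using bdd_above_dual_ratios[OF assms(1-6)] by (intro cSup_upper) simp_all
  also have "\<dots> \<le> dual_norm G \<theta> \<tau> \<delta> \<V>h N R"
    unfolding dual_norm_def using \<open>N \<ge> 1\<close> by (intro Max_ge) auto
  finally show ?thesis .
qed

section \<open>Stability of the discrete problem\<close>

lemma square_absorption: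
  fixes s q x :: real
  assumes "s\<^sup>2 \<le> 2 * x + 2 * (q * s)"
  shows "s\<^sup>2 \<le> 4 * x + 4 * q\<^sup>2"
proof -
  have "0 \<le> (2 * q - s)\<^sup>2"
    by simp
  then show ?thesis
    using assms by (simp add: power2_diff power_mult_distrib)
qed

lemma discrete_solution_energy_norm_bound:
  assumes G: "skew_operator_on \<V> G" and sub: "subspace \<V>h" "\<V>h \<subseteq> \<V>"
    and \<theta>: "1 / 2 \<le> \<theta>" "\<theta> \<le> 1" and \<tau>: "\<tau> > 0" and \<delta>: "\<delta> = \<theta> * \<tau>" and N: "N \<ge> 1"
    and sol: "discrete_solution G \<theta> \<tau> \<delta> \<V>h N R U"
  shows "energy_norm_sq G \<theta> \<tau> \<delta> N U
    \<le> 4 * ((norm (T_op G \<delta> (U 0)))\<^sup>2 + (dual_norm G \<theta> \<tau> \<delta> \<V>h N R)\<^sup>2)"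
proof -
  define x where "x = (norm (T_op G \<delta> (U 0)))\<^sup>2"
  define q where "q = dual_norm G \<theta> \<tau> \<delta> \<V>h N R"
  define s where "s = sqrt (dual_denom_sq G \<theta> \<tau> \<delta> N U)"
  have nonneg: "\<tau> \<ge> 0" "\<delta> \<ge> 0"
    using \<theta> \<tau> \<delta> by simp_all
  have q: "0 \<le> q"
    unfolding q_def by (rule dual_norm_nonneg[OF G sub \<theta> \<tau> \<delta> N])
  have x: "0 \<le> x"
    by (simp add: x_def)
  have denom_mono: "dual_denom_sq G \<theta> \<tau> \<delta> m U \<le> dual_denom_sq G \<theta> \<tau> \<delta> N U" if "m \<in> {1..N}" for m
    using energy_norm_sq_mono[OF \<theta>(1) nonneg, of m N] that by (simp add: dual_denom_sq_def)
  have "0 \<le> energy G \<delta> U N + \<tau> * (\<Sum>n=1..N. dissipation G \<theta> \<tau> \<delta> U n)"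
    using \<theta>(1) nonneg
    by (intro add_nonneg_nonneg mult_nonneg_nonneg sum_nonneg dissipation_nonneg)
      (simp_all add: energy_def)
  also have "\<dots> \<le> energy_norm_sq G \<theta> \<tau> \<delta> N U"
    by (rule energy_plus_dissipation_le_energy_norm_sq[OF N])
  finally have s: "0 \<le> s" "s\<^sup>2 = x + energy_norm_sq G \<theta> \<tau> \<delta> N U"
    using x by (simp_all add: s_def x_def dual_denom_sq_def)
  have "energy G \<delta> U m + \<tau> * (\<Sum>n=1..m. dissipation G \<theta> \<tau> \<delta> U n) \<le> x / 2 + q * s"
    if m: "m \<in> {1..N}" for m
  proof (cases "dual_denom_sq G \<theta> \<tau> \<delta> m U > 0")
    case True
    have "\<tau> * (\<Sum>n=1..m. inner (R n) (P_op G \<theta> \<tau> \<delta> U n))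
        \<le> q * sqrt (dual_denom_sq G \<theta> \<tau> \<delta> m U)"
      unfolding q_def using sol m
      by (intro forcing_work_le_dual_norm[OF G sub \<theta> \<tau> \<delta> m _ True])
        (simp add: discrete_solution_def)
    also have "\<dots> \<le> q * s"
      unfolding s_def using q denom_mono[OF m] by (intro mult_left_mono real_sqrt_le_mono)
    finally show ?thesis
      using discrete_solution_energy_balance[OF G sub _ sol, of m] \<tau> m
      by (simp add: energy_def x_def)
  next
    \<comment> \<open>The dual norm says nothing here, but a vanishing denominator dominates the left-hand side.\<close>
    case False
    then have "energy_norm_sq G \<theta> \<tau> \<delta> m U \<le> 0"
      using x unfolding dual_denom_sq_def x_def by linarith
    then have "energy G \<delta> U m + \<tau> * (\<Sum>n=1..m. dissipation G \<theta> \<tau> \<delta> U n) \<le> 0"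
      using energy_plus_dissipation_le_energy_norm_sq[of m G \<delta> U \<tau> \<theta>] m by simp
    moreover have "0 \<le> x / 2 + q * s"
      using x q s(1) by simp
    ultimately show ?thesis by linarith
  qed
  then have "energy_norm_sq G \<theta> \<tau> \<delta> N U \<le> 2 * (x / 2 + q * s)"
    by (rule energy_norm_sq_le[OF \<theta>(1) nonneg N])
  then have "s\<^sup>2 \<le> 2 * x + 2 * (q * s)"
    by (simp add: s(2))
  then have "s\<^sup>2 \<le> 4 * x + 4 * q\<^sup>2"
    by (rule square_absorption)
  then show ?thesis
    using x by (simp add: s(2) x_def[symmetric] q_def[symmetric])
qed

theorem corollary4p1:
  fixes \<V> :: "'a::{real_inner, complete_space} set"
    and G :: "'a \<Rightarrow> 'a"
    and \<theta> :: real
  assumes "subspace \<V>" and "closure \<V> = UNIV"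
    and "skew_operator_on \<V> G"
    and "1 / 2 \<le> \<theta>" and "\<theta> \<le> 1"
  shows "(\<exists>cE>0. \<exists>CE>0. \<forall>\<V>h. conforming_space \<V> \<V>h \<longrightarrow> (\<forall>\<tau>>0. \<forall>\<delta>. \<delta> = \<theta> * \<tau> \<longrightarrow> (\<forall>N\<ge>1.
            (\<forall>V. (\<forall>n\<in>{0..N}. V n \<in> \<V>h) \<longrightarrow> (\<forall>m\<in>{1..N}.
                cE * (norm (T_op G \<delta> (V m)))\<^sup>2 \<le> energy G \<delta> V m
              \<and> cE * (\<delta> * (norm (A_op G \<theta> \<tau> V m))\<^sup>2) \<le> dissipation G \<theta> \<tau> \<delta> V m))
          \<and> (\<forall>R V. discrete_solution G \<theta> \<tau> \<delta> \<V>h N R V \<longrightarrow> (\<forall>m\<in>{1..N}.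
                energy G \<delta> V m + \<tau> * (\<Sum>n=1..m. dissipation G \<theta> \<tau> \<delta> V n)
                  \<le> CE * (norm (T_op G \<delta> (V 0)))\<^sup>2
                    + CE * (\<tau> * (\<Sum>n=1..m. inner (R n) (P_op G \<theta> \<tau> \<delta> V n))))))))
       \<and> (\<exists>C>0. \<forall>\<V>h. conforming_space \<V> \<V>h \<longrightarrow> (\<forall>\<tau>>0. \<forall>\<delta>. \<delta> = \<theta> * \<tau> \<longrightarrow> (\<forall>N\<ge>1.
            \<forall>F U. discrete_solution G \<theta> \<tau> \<delta> \<V>h N (mean_op \<theta> F) U \<longrightarrow>
              energy_norm_sq G \<theta> \<tau> \<delta> N U
                \<le> C * ((norm (T_op G \<delta> (U 0)))\<^sup>2
                       + (dual_norm G \<theta> \<tau> \<delta> \<V>h N (mean_op \<theta> F))\<^sup>2))))"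
proof (rule conjI)
  note G = assms(3) and \<theta> = assms(4,5)
  have half: "1 / 2 * (norm (T_op G \<delta> (V m)))\<^sup>2 \<le> energy G \<delta> V m
      \<and> 1 / 2 * (\<delta> * (norm (A_op G \<theta> \<tau> V m))\<^sup>2) \<le> dissipation G \<theta> \<tau> \<delta> V m"
    if "\<tau> > 0" "\<delta> = \<theta> * \<tau>" for \<tau> \<delta> and V :: "nat \<Rightarrow> 'a" and m
  proof -
    have "0 \<le> \<delta> * (norm (A_op G \<theta> \<tau> V m))\<^sup>2"
      using \<theta> that by simp
    moreover have "\<delta> * (norm (A_op G \<theta> \<tau> V m))\<^sup>2 \<le> dissipation G \<theta> \<tau> \<delta> V m"
      using \<theta> that by (intro dissipation_ge_residual) simp_all
    ultimately show ?thesis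
      by (simp only: energy_def) linarith
  qed
  have balance: "energy G \<delta> V m + \<tau> * (\<Sum>n=1..m. dissipation G \<theta> \<tau> \<delta> V n)
      \<le> 1 * (norm (T_op G \<delta> (V 0)))\<^sup>2 + 1 * (\<tau> * (\<Sum>n=1..m. inner (R n) (P_op G \<theta> \<tau> \<delta> V n)))"
    if "conforming_space \<V> \<V>h" "\<tau> > 0" "discrete_solution G \<theta> \<tau> \<delta> \<V>h N R V" "m \<in> {1..N}"
    for \<V>h \<tau> \<delta> N R V m
    using discrete_solution_energy_balance[OF G _ _ _ that(3), of m] that
    by (simp add: conforming_space_def energy_def)
  show "\<exists>cE>0. \<exists>CE>0. \<forall>\<V>h. conforming_space \<V> \<V>h \<longrightarrow> (\<forall>\<tau>>0. \<forall>\<delta>. \<delta> = \<theta> * \<tau> \<longrightarrow> (\<forall>N\<ge>1.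
            (\<forall>V. (\<forall>n\<in>{0..N}. V n \<in> \<V>h) \<longrightarrow> (\<forall>m\<in>{1..N}.
                cE * (norm (T_op G \<delta> (V m)))\<^sup>2 \<le> energy G \<delta> V m
              \<and> cE * (\<delta> * (norm (A_op G \<theta> \<tau> V m))\<^sup>2) \<le> dissipation G \<theta> \<tau> \<delta> V m))
          \<and> (\<forall>R V. discrete_solution G \<theta> \<tau> \<delta> \<V>h N R V \<longrightarrow> (\<forall>m\<in>{1..N}.
                energy G \<delta> V m + \<tau> * (\<Sum>n=1..m. dissipation G \<theta> \<tau> \<delta> V n)
                  \<le> CE * (norm (T_op G \<delta> (V 0)))\<^sup>2
                    + CE * (\<tau> * (\<Sum>n=1..m. inner (R n) (P_op G \<theta> \<tau> \<delta> V n)))))))"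
    by (rule exI[of _ "1 / 2"], rule conjI, simp, rule exI[of _ 1], rule conjI, simp)
      (intro allI impI ballI conjI half[THEN conjunct1] half[THEN conjunct2] balance; assumption)
  show "\<exists>C>0. \<forall>\<V>h. conforming_space \<V> \<V>h \<longrightarrow> (\<forall>\<tau>>0. \<forall>\<delta>. \<delta> = \<theta> * \<tau> \<longrightarrow> (\<forall>N\<ge>1.
            \<forall>F U. discrete_solution G \<theta> \<tau> \<delta> \<V>h N (mean_op \<theta> F) U \<longrightarrow>
              energy_norm_sq G \<theta> \<tau> \<delta> N U
                \<le> C * ((norm (T_op G \<delta> (U 0)))\<^sup>2
                       + (dual_norm G \<theta> \<tau> \<delta> \<V>h N (mean_op \<theta> F))\<^sup>2)))"
    using discrete_solution_energy_norm_bound[OF G _ _ \<theta>]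
    by (intro exI[of _ 4]) (simp add: conforming_space_def)
qed

end
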